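(* Let $n\ge1$ and let $\varphi\in\operatorname{PSHS}_0$ be a maximal plurisubharmonic singularity at $0\in\mathbb C^n$ that is additive. Then $\varphi$ is an extreme singularity.
   Context: Plurisubharmonic (psh) functions are understood to be not identically $-\infty$. **Singularities.** $\operatorname{PSHG}_0$ is the convex cone of germs at $0\in\mathbb C^n$ of psh functions. For $u,v\in\operatorname{PSHG}_0$ write $u\sim v$ if $u(z)=v(z)+O(1)$ as $z\to0$. The equivalence class $\operatorname{cl}(u)$ is the plurisubharmonic singularity of $u$, and $\operatorname{PSHS}_0$ is the set of all these classes. It is a convex cone with $\operatorname{cl}(u)+\operatorname{cl}(v)=\operatorname{cl}(u+v)$ and $\lambda\operatorname{cl}(u)=\operatorname{cl}(\lambda u)$ for $\lambda\ge0$ (so $0\cdot\operatorname{cl}(u)=\operatorname{cl}(0)$). **Extreme singularity.** $\mathfrak u\in\operatorname{PSHS}_0$ is extreme if $\mathfrak u=\mathfrak u_1+\mathfrak u_2$ with $\mathfrak u_1,\mathfrak u_2\in\operatorname{PSHS}_0$ implies $\mathfrak u_i=\lambda_i\mathfrak u$ with some $\lambda_i\ge0$, $i=1,2$. **Maximal singularity.** A singularity is isolated if its representatives take the value $-\infty$ at $0$ and are locally bounded on a punctured neighborhood of $0$. An isolated singularity $\varphi\in\operatorname{PSHS}_0$ is called maximal if it has a representative that is a maximal psh function on a punctured neighborhood of $0$. (A psh function $w$ on an open set $D$ is maximal if for every relatively compact open $G\subset D$ and every upper semicontinuous function $v$ on $\overline G$ that is psh in $G$ and satisfies $v\le w$ on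 $\partial G$, one has $v\le w$ in $G$.) **Relative type.** For $\mathfrak u\in\operatorname{PSHS}_0$ and a maximal singularity $\varphi$ (denoting also by $\varphi$ a representative), $$\sigma(\mathfrak u,\varphi)=\liminf_{z\to0}\frac{u(z)}{\varphi(z)},\qquad u\in\mathfrak u,$$ which does not depend on the choice of representatives. **Additive singularity.** A maximal singularity $\varphi$ is additive if $\sigma\left(\sum_i\mathfrak u_i,\varphi\right)=\sum_i\sigma(\mathfrak u_i,\varphi)$ for all finite families $\mathfrak u_i\in\operatorname{PSHS}_0$. *)

theory Defs
  imports "HOL-Analysis.Analysis"
begin

section \<open>Plurisubharmonic functions\<close>

definition usc_on :: "'a::topological_space set \<Rightarrow> ('a \<Rightarrow> ereal) \<Rightarrow> bool" where
  "usc_on S u \<longleftrightarrow> (\<forall>c. openin (top_of_set S) {z \<in> S. u z < c})"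

text \<open>The mean value of \<open>u\<close> over the circle \<open>{a + \<zeta> b : |\<zeta>| = 1}\<close>. The integral is the
  difference of the integrals of the positive and the negative part of \<open>u\<close>
  (\<^const>\<open>e2ennreal\<close> sends negative values to 0). If \<open>u\<close> is upper semicontinuous and
  \<open>< \<infinity>\<close> on the circle, the first integral is finite, so \<open>\<infinity> - \<infinity>\<close> does not occur; the mean
  value may be \<open>-\<infinity>\<close>.\<close>

definition circle_mean :: "(complex^'n \<Rightarrow> ereal) \<Rightarrow> complex^'n \<Rightarrow> complex^'n \<Rightarrow> ereal" where
  "circle_mean u a b = ereal (1 / (2 * pi)) *
     (enn2ereal (\<integral>\<^sup>+ t \<in> {0..2*pi}. e2ennreal (u (a + cis t *s b)) \<partial>lborel)
      - enn2ereal (\<integral>\<^sup>+ t \<in> {0..2*pi}. e2ennreal (- u (a + cis t *s b)) \<partial>lborel))"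

definition psh_on :: "(complex^'n) set \<Rightarrow> (complex^'n \<Rightarrow> ereal) \<Rightarrow> bool" where
  "psh_on D u \<longleftrightarrow> open D \<and> (\<forall>z\<in>D. u z < \<infinity>) \<and> (\<exists>z\<in>D. u z \<noteq> -\<infinity>) \<and> usc_on D u \<and>
     (\<forall>a b. {a + \<zeta> *s b |\<zeta>. cmod \<zeta> \<le> 1} \<subseteq> D \<longrightarrow> u a \<le> circle_mean u a b)"

definition maximal_psh_on :: "(complex^'n) set \<Rightarrow> (complex^'n \<Rightarrow> ereal) \<Rightarrow> bool" where
  "maximal_psh_on D w \<longleftrightarrow> psh_on D w \<and>
     (\<forall>G v. open G \<and> compact (closure G) \<and> closure G \<subseteq> D \<and>
            usc_on (closure G) v \<and> psh_on G v \<and> (\<forall>z\<in>frontier G. v z \<le> w z)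
        \<longrightarrow> (\<forall>z\<in>G. v z \<le> w z))"

section \<open>Plurisubharmonic singularities at the origin\<close>

text \<open>Germs are represented by functions on the whole space, whose values away from 0 are
  irrelevant. Balls (rather than arbitrary open neighbourhoods) are used because on a connected
  set ``not identically \<open>-\<infinity>\<close>'' is a property of the germ.\<close>

definition PSHG0 :: "(complex^'n \<Rightarrow> ereal) set" where
  "PSHG0 = {u. \<exists>r>0. psh_on (ball 0 r) u}"

definition sing_equiv :: "(complex^'n \<Rightarrow> ereal) \<Rightarrow> (complex^'n \<Rightarrow> ereal) \<Rightarrow> bool" where
  "sing_equiv u v \<longleftrightarrow>
     (\<exists>C::real. \<forall>\<^sub>F z in at 0. u z \<le> v z + ereal C \<and> v z \<le> u z + ereal C)"

text \<open>Functions with the same germ at 0 are equivalent, so \<open>cl u\<close> depends only on the germ.\<close>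

definition cl :: "(complex^'n \<Rightarrow> ereal) \<Rightarrow> (complex^'n \<Rightarrow> ereal) set" where
  "cl u = {v \<in> PSHG0. sing_equiv v u}"

definition PSHS0 :: "(complex^'n \<Rightarrow> ereal) set set" where
  "PSHS0 = cl ` PSHG0"

text \<open>The cone operations, defined through representatives; see \<open>sing_add_cl\<close> and
  \<open>sing_scale_cl\<close> below. For \<open>c = 0\<close> note that \<open>0 * (-\<infinity>) = 0\<close> in \<^typ>\<open>ereal\<close>.\<close>

definition sing_add ::
  "(complex^'n \<Rightarrow> ereal) set \<Rightarrow> (complex^'n \<Rightarrow> ereal) set \<Rightarrow> (complex^'n \<Rightarrow> ereal) set" where
  "sing_add U V = (\<Union>u\<in>U. \<Union>v\<in>V. cl (\<lambda>z. u z + v z))"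

definition sing_scale ::
  "real \<Rightarrow> (complex^'n \<Rightarrow> ereal) set \<Rightarrow> (complex^'n \<Rightarrow> ereal) set" where
  "sing_scale c U = (\<Union>u\<in>U. cl (\<lambda>z. ereal c * u z))"

definition sing_zero :: "(complex^'n \<Rightarrow> ereal) set" where
  "sing_zero = cl (\<lambda>z. 0)"

definition sing_sum :: "(complex^'n \<Rightarrow> ereal) set list \<Rightarrow> (complex^'n \<Rightarrow> ereal) set" where
  "sing_sum Us = foldr sing_add Us sing_zero"

definition extreme_sing :: "(complex^'n \<Rightarrow> ereal) set \<Rightarrow> bool" where
  "extreme_sing U \<longleftrightarrow> U \<in> PSHS0 \<and>
     (\<forall>U1\<in>PSHS0. \<forall>U2\<in>PSHS0. U = sing_add U1 U2 \<longrightarrow>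
        (\<exists>c1\<ge>0. U1 = sing_scale c1 U) \<and> (\<exists>c2\<ge>0. U2 = sing_scale c2 U))"

definition locally_bounded_on :: "(complex^'n) set \<Rightarrow> (complex^'n \<Rightarrow> ereal) \<Rightarrow> bool" where
  "locally_bounded_on S u \<longleftrightarrow>
     (\<forall>z\<in>S. \<exists>e>0. \<exists>M::real. \<forall>w \<in> S \<inter> ball z e. \<bar>u w\<bar> \<le> ereal M)"

definition isolated_sing :: "(complex^'n \<Rightarrow> ereal) set \<Rightarrow> bool" where
  "isolated_sing \<Phi> \<longleftrightarrow> \<Phi> \<in> PSHS0 \<and>
     (\<forall>\<phi>\<in>\<Phi>. \<phi> 0 = -\<infinity> \<and> (\<exists>r>0. locally_bounded_on (ball 0 r - {0}) \<phi>))"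

definition maximal_sing :: "(complex^'n \<Rightarrow> ereal) set \<Rightarrow> bool" where
  "maximal_sing \<Phi> \<longleftrightarrow> isolated_sing \<Phi> \<and>
     (\<exists>\<phi>\<in>\<Phi>. \<exists>r>0. maximal_psh_on (ball 0 r - {0}) \<phi>)"

text \<open>The common value of the lower limits over all choices of representatives; existence and
  uniqueness for isolated \<open>\<Phi>\<close> are shown in \<open>rel_type_eq\<close> below. Near 0 a representative of an
  isolated \<open>\<Phi>\<close> is finite and negative off the origin, so a value \<open>-\<infinity>\<close> of the numerator
  gives the quotient \<open>\<infinity>\<close>.\<close>

definition rel_type ::
  "(complex^'n \<Rightarrow> ereal) set \<Rightarrow> (complex^'n \<Rightarrow> ereal) set \<Rightarrow> ereal" where
  "rel_type U \<Phi> = (THE s. \<forall>u\<in>U. \<forall>\<phi>\<in>\<Phi>. s = Liminf (at 0) (\<lambda>z. u z / \<phi> z))"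

definition additive_sing :: "(complex^'n \<Rightarrow> ereal) set \<Rightarrow> bool" where
  "additive_sing \<Phi> \<longleftrightarrow> maximal_sing \<Phi> \<and>
     (\<forall>Us. set Us \<subseteq> PSHS0 \<longrightarrow>
        rel_type (sing_sum Us) \<Phi> = (\<Sum>U\<leftarrow>Us. rel_type U \<Phi>))"

section \<open>Well-definedness\<close>

lemma sing_equiv_refl: "sing_equiv u u"
  unfolding sing_equiv_def by (rule exI[of _ 0]) (simp flip: zero_ereal_def)

lemma sing_equiv_sym: "sing_equiv u v \<Longrightarrow> sing_equiv v u"
  unfolding sing_equiv_def by (simp add: conj_commute)

lemma sing_equiv_trans:
  assumes "sing_equiv u v" "sing_equiv v w"
  shows "sing_equiv u w"
proof -
  obtain C D where C: "\<forall>\<^sub>F z in at 0. u z \<le> v z + ereal C \<and> v z \<le> u z + ereal C"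
    and D: "\<forall>\<^sub>F z in at 0. v z \<le> w z + ereal D \<and> w z \<le> v z + ereal D"
    using assms unfolding sing_equiv_def by blast
  from C D have "\<forall>\<^sub>F z in at 0. u z \<le> w z + ereal (C + D) \<and> w z \<le> u z + ereal (C + D)"
  proof eventually_elim
    case (elim z)
    then show ?case
      by (cases "u z"; cases "v z"; cases "w z") auto
  qed
  then show ?thesis unfolding sing_equiv_def by blast
qed

lemma cl_eq: "sing_equiv u v \<Longrightarrow> cl u = cl v"
  unfolding cl_def using sing_equiv_trans sing_equiv_sym by blast

lemma mem_cl: "u \<in> PSHG0 \<Longrightarrow> u \<in> cl u"
  unfolding cl_def using sing_equiv_refl by blast

lemma PSHS0_nonempty: "U \<in> PSHS0 \<Longrightarrow> U \<noteq> {}"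
  unfolding PSHS0_def using mem_cl by blast

lemma PSHS0_reps:
  assumes "U \<in> PSHS0" "u \<in> U" "v \<in> U"
  shows "u \<in> PSHG0" "sing_equiv u v"
proof -
  show "u \<in> PSHG0" using assms unfolding PSHS0_def cl_def by blast
  show "sing_equiv u v"
    using assms sing_equiv_trans sing_equiv_sym unfolding PSHS0_def cl_def by blast
qed

lemma sing_equiv_add:
  assumes "sing_equiv u u'" "sing_equiv v v'"
  shows "sing_equiv (\<lambda>z. u z + v z) (\<lambda>z. u' z + v' z)"
proof -
  obtain C D where C: "\<forall>\<^sub>F z in at 0. u z \<le> u' z + ereal C \<and> u' z \<le> u z + ereal C"
    and D: "\<forall>\<^sub>F z in at 0. v z \<le> v' z + ereal D \<and> v' z \<le> v z + ereal D"
    using assms unfolding sing_equiv_def by blast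
  from C D have "\<forall>\<^sub>F z in at 0. u z + v z \<le> u' z + v' z + ereal (C + D) \<and>
      u' z + v' z \<le> u z + v z + ereal (C + D)"
  proof eventually_elim
    case (elim z)
    then show ?case
      by (cases "u z"; cases "v z"; cases "u' z"; cases "v' z") auto
  qed
  then show ?thesis unfolding sing_equiv_def by blast
qed

lemma sing_equiv_scale:
  assumes "sing_equiv u u'" "0 \<le> c"
  shows "sing_equiv (\<lambda>z. ereal c * u z) (\<lambda>z. ereal c * u' z)"
proof (cases "c = 0")
  case True
  then show ?thesis by (simp add: sing_equiv_refl flip: zero_ereal_def)
next
  case False
  with assms have c: "c > 0" by simp
  obtain C where C: "\<forall>\<^sub>F z in at 0. u z \<le> u' z + ereal C \<and> u' z \<le> u z + ereal C"
    using assms unfolding sing_equiv_def by blast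
  from C have "\<forall>\<^sub>F z in at 0. ereal c * u z \<le> ereal c * u' z + ereal (c * C) \<and>
      ereal c * u' z \<le> ereal c * u z + ereal (c * C)"
  proof eventually_elim
    case (elim z)
    then show ?case using c
      by (cases "u z"; cases "u' z") (auto simp flip: distrib_left)
  qed
  then show ?thesis unfolding sing_equiv_def by blast
qed

lemma sing_add_cl:
  assumes "u \<in> PSHG0" "v \<in> PSHG0"
  shows "sing_add (cl u) (cl v) = cl (\<lambda>z. u z + v z)"
proof -
  have "cl (\<lambda>z. u' z + v' z) = cl (\<lambda>z. u z + v z)" if "u' \<in> cl u" "v' \<in> cl v" for u' v'
    using that by (intro cl_eq sing_equiv_add) (auto simp: cl_def)
  then show ?thesis
    unfolding sing_add_def using mem_cl[OF assms(1)] mem_cl[OF assms(2)] by blast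
qed

lemma sing_scale_cl:
  assumes "u \<in> PSHG0" "0 \<le> c"
  shows "sing_scale c (cl u) = cl (\<lambda>z. ereal c * u z)"
proof -
  have "cl (\<lambda>z. ereal c * u' z) = cl (\<lambda>z. ereal c * u z)" if "u' \<in> cl u" for u'
    using that assms(2) by (intro cl_eq sing_equiv_scale) (auto simp: cl_def)
  then show ?thesis
    unfolding sing_scale_def using mem_cl[OF assms(1)] by blast
qed

lemma PSHG0_less_PInf:
  assumes "u \<in> PSHG0"
  shows "\<forall>\<^sub>F z in at 0. u z < \<infinity>"
proof -
  obtain r where r: "r > 0" "\<forall>z\<in>ball 0 r. u z < \<infinity>"
    using assms unfolding PSHG0_def psh_on_def by blast
  then show ?thesis
    unfolding eventually_at by (intro exI[of _ r]) (auto simp: dist_commute)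
qed

lemma isolated_sing_finite:
  assumes "isolated_sing \<Phi>" "\<phi> \<in> \<Phi>"
  shows "\<forall>\<^sub>F z in at 0. \<bar>\<phi> z\<bar> < \<infinity>"
proof -
  obtain r where r: "r > 0" "locally_bounded_on (ball 0 r - {0}) \<phi>"
    using assms unfolding isolated_sing_def by blast
  have "\<bar>\<phi> z\<bar> < \<infinity>" if z: "z \<in> ball 0 r - {0}" for z
  proof -
    from r(2) z obtain e M where "e > 0" "\<forall>w\<in>(ball 0 r - {0}) \<inter> ball z e. \<bar>\<phi> w\<bar> \<le> ereal M"
      unfolding locally_bounded_on_def by blast
    with z have "\<bar>\<phi> z\<bar> \<le> ereal M" by auto
    then show ?thesis using ereal_infty_less(1) le_less_trans by auto
  qed
  then show ?thesis
    unfolding eventually_at using r(1) by (intro exI[of _ r]) (auto simp: dist_commute)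
qed

lemma isolated_sing_less:
  assumes "isolated_sing \<Phi>" "\<phi> \<in> \<Phi>"
  shows "\<forall>\<^sub>F z in at 0. \<phi> z < ereal K"
proof -
  have "\<phi> \<in> PSHG0" "\<phi> 0 = -\<infinity>"
    using assms PSHS0_reps(1)[of \<Phi> \<phi> \<phi>] unfolding isolated_sing_def by auto
  then obtain r where r: "r > 0" "usc_on (ball 0 r) \<phi>"
    unfolding PSHG0_def psh_on_def by blast
  then have "openin (top_of_set (ball 0 r)) {z \<in> ball 0 r. \<phi> z < ereal K}"
    unfolding usc_on_def by blast
  then have "open {z \<in> ball 0 r. \<phi> z < ereal K}"
    using openin_open_eq by blast
  moreover have "0 \<in> {z \<in> ball 0 r. \<phi> z < ereal K}"
    using r \<open>\<phi> 0 = -\<infinity>\<close> by simp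
  ultimately have "\<forall>\<^sub>F z in nhds 0. z \<in> {z \<in> ball 0 r. \<phi> z < ereal K}"
    by (rule eventually_nhds_in_open)
  then have "\<forall>\<^sub>F z in nhds 0. \<phi> z < ereal K"
    by eventually_elim simp
  then show ?thesis
    unfolding eventually_at_filter by eventually_elim simp
qed

lemma Liminf_quotient_le:
  assumes U: "U \<in> PSHS0" "u \<in> U" "u' \<in> U"
    and \<Phi>: "isolated_sing \<Phi>" "\<phi> \<in> \<Phi>" "\<phi>' \<in> \<Phi>"
  shows "Liminf (at 0) (\<lambda>z. u z / \<phi> z) \<le> Liminf (at 0) (\<lambda>z. u' z / \<phi>' z)"
  unfolding le_Liminf_iff
proof (intro allI impI)
  fix y assume y: "y < Liminf (at 0) (\<lambda>z. u z / \<phi> z)"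
  then obtain s where s: "y < ereal s" "ereal s < Liminf (at 0) (\<lambda>z. u z / \<phi> z)"
    using ereal_dense2 by blast
  then obtain t where t: "ereal s < ereal t" "ereal t < Liminf (at 0) (\<lambda>z. u z / \<phi> z)"
    using ereal_dense2 by blast
  have ev: "\<forall>\<^sub>F z in at 0. ereal t < u z / \<phi> z"
    using t(2) less_LiminfD by blast
  obtain C where C: "\<forall>\<^sub>F z in at 0. u z \<le> u' z + ereal C \<and> u' z \<le> u z + ereal C"
    using PSHS0_reps(2)[OF U] unfolding sing_equiv_def by blast
  have "\<Phi> \<in> PSHS0" using \<Phi> unfolding isolated_sing_def by blast
  then obtain D where D: "\<forall>\<^sub>F z in at 0. \<phi> z \<le> \<phi>' z + ereal D \<and> \<phi>' z \<le> \<phi> z + ereal D"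
    using PSHS0_reps(2)[OF _ \<Phi>(2,3)] unfolding sing_equiv_def by blast
  let ?K = "min 0 (- (\<bar>t\<bar> * D + C) / (t - s))"
  from ev C D isolated_sing_finite[OF \<Phi>(1,2)] isolated_sing_finite[OF \<Phi>(1,3)]
    isolated_sing_less[OF \<Phi>(1,2), of 0] isolated_sing_less[OF \<Phi>(1,3), of ?K]
    PSHG0_less_PInf[OF PSHS0_reps(1)[OF U]] 
  have "\<forall>\<^sub>F z in at 0. ereal s < u' z / \<phi>' z"
  proof eventually_elim
    case (elim z)
    obtain p p' where p: "\<phi> z = ereal p" "\<phi>' z = ereal p'"
      using elim by (metis ereal_infty_less(1) abs_neq_infinity_cases)
    have p0: "p < 0" "p' < 0" "p' < - (\<bar>t\<bar> * D + C) / (t - s)"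
      using elim p by (auto simp: zero_ereal_def)
    have st: "s < t" using t(1) by simp
    show ?case
    proof (cases "u z")
      case (real x)
      then obtain x' where x': "u' z = ereal x'" using elim by (cases "u' z") auto
      have "t < x / p" using elim real p p0 by simp
      then have 1: "x < t * p" using p0 by (simp add: field_simps)
      have 2: "x' \<le> x + C" using elim real x' by simp
      have "p \<le> p' + D" "p' \<le> p + D" using elim(3) p by simp_all
      then have "\<bar>p - p'\<bar> \<le> D" by linarith
      then have "\<bar>t\<bar> * \<bar>p - p'\<bar> \<le> \<bar>t\<bar> * D" by (intro mult_left_mono) auto
      then have "t * (p - p') \<le> \<bar>t\<bar> * D"
        by (metis abs_ge_self abs_mult order_trans)
      then have 3: "t * p \<le> t * p' + \<bar>t\<bar> * D" by (simp add: algebra_simps)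
      have "p' * (t - s) < - (\<bar>t\<bar> * D + C)"
        using p0(3) st by (subst (asm) pos_less_divide_eq) auto
      with 1 2 3 have "x' < s * p'" by (simp add: algebra_simps)
      then have "s < x' / p'" using p0 by (simp add: field_simps)
      then show ?thesis using p0 x' p by simp
    next
      case PInf
      then show ?thesis using elim by simp
    next
      case MInf
      then have "u' z = -\<infinity>" using elim by (cases "u' z") auto
      then show ?thesis using p p0 by (simp add: divide_ereal_def)
    qed
  qed
  then show "\<forall>\<^sub>F z in at 0. y < u' z / \<phi>' z"
    using s(1) by (auto elim!: eventually_mono)
qed

lemma rel_type_eq:
  assumes "U \<in> PSHS0" "isolated_sing \<Phi>" "u \<in> U" "\<phi> \<in> \<Phi>"
  shows "rel_type U \<Phi> = Liminf (at 0) (\<lambda>z. u z / \<phi> z)"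
  unfolding rel_type_def
proof (rule the_equality)
  show "\<forall>u'\<in>U. \<forall>\<phi>'\<in>\<Phi>. Liminf (at 0) (\<lambda>z. u z / \<phi> z) = Liminf (at 0) (\<lambda>z. u' z / \<phi>' z)"
    using assms by (intro ballI antisym Liminf_quotient_le) auto
qed (use assms in blast)

end

theory Submission
  imports Defs
begin

text \<open>
  The heart of the matter is a sharp bound by the relative type: if \<open>\<phi>\<close> is maximal near 0 and
  \<open>u\<close> has finite type \<open>\<sigma>\<close> relative to \<open>\<phi>\<close>, then \<open>u \<le> \<sigma> \<phi> + O(1)\<close> (\<open>psh_le_rel_type\<close>). The
  definition of the lower limit only gives \<open>u \<le> t \<phi>\<close> close to 0 for each \<open>t < \<sigma>\<close>, on a
  neighbourhood that shrinks as \<open>t\<close> tends to \<open>\<sigma>\<close>. Maximality removes this defect: on a shell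
  \<open>d < |z| < r\<close> with \<open>r\<close> fixed, \<open>(u - C) / t\<close> is a competitor that lies below \<open>\<phi>\<close> on the inner
  sphere (because \<open>u \<le> t \<phi>\<close> there) and on the outer sphere (if \<open>C\<close> is large, uniformly in
  \<open>t\<close>), hence below \<open>\<phi>\<close> in the shell (\<open>maximal_psh_shell_bound\<close>). As \<open>C\<close> depends neither on \<open>d\<close>
  nor on \<open>t\<close>, one may let \<open>d\<close> tend to 0 and then \<open>t\<close> to \<open>\<sigma>\<close>.

  Now let \<open>\<phi> = u\<^sub>1 + u\<^sub>2 + O(1)\<close>, with relative types \<open>s\<^sub>1\<close> and \<open>s\<^sub>2\<close>. These are nonnegative, and
  additivity together with \<open>\<sigma>(\<phi>, \<phi>) = 1\<close> gives \<open>s\<^sub>1 + s\<^sub>2 = 1\<close>. Therefore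
  \<open>u\<^sub>1 = \<phi> - u\<^sub>2 + O(1) \<ge> \<phi> - s\<^sub>2 \<phi> + O(1) = s\<^sub>1 \<phi> + O(1)\<close>, which is the converse of the bound
  \<open>u\<^sub>1 \<le> s\<^sub>1 \<phi> + O(1)\<close>. So \<open>u\<^sub>1\<close> has the singularity \<open>s\<^sub>1 \<phi>\<close>, and likewise \<open>u\<^sub>2\<close>.
\<close>

section \<open>Affine images of plurisubharmonic functions\<close>

lemma usc_on_subset:
  assumes "usc_on T u" "S \<subseteq> T"
  shows "usc_on S u"
  unfolding usc_on_def
proof
  fix c
  have "openin (top_of_set T) {z \<in> T. u z < c}"
    using assms(1) unfolding usc_on_def by blast
  then obtain W where W: "open W" "{z \<in> T. u z < c} = T \<inter> W"
    unfolding openin_open by blast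
  have "{z \<in> S. u z < c} = S \<inter> W"
    using W(2) assms(2) by blast
  with W(1) show "openin (top_of_set S) {z \<in> S. u z < c}"
    unfolding openin_open by blast
qed

lemma ereal_affine_less_iff:
  fixes x d :: ereal
  assumes "0 < c"
  shows "ereal c * x + ereal K < d \<longleftrightarrow> x < (d - ereal K) / ereal c"
  using assms by (cases x; cases d) (auto simp: field_simps)

lemma usc_on_affine:
  assumes "usc_on S u" "0 < c"
  shows "usc_on S (\<lambda>z. ereal c * u z + ereal K)"
  using assms unfolding usc_on_def by (simp add: ereal_affine_less_iff)

lemma psh_on_subset:
  assumes "psh_on D u" "open G" "G \<subseteq> D" "\<exists>z\<in>G. u z \<noteq> -\<infinity>"
  shows "psh_on G u"
  using assms usc_on_subset[of D u G] unfolding psh_on_def by (meson order_trans subsetD)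

text \<open>Measurability is what allows the positive and negative parts in the circle mean to be
  integrated additively. The strict sublevel sets are open relative to the parameter interval,
  up to the complement of the interval, where the value 0 is taken.\<close>

lemma usc_on_circle_measurable:
  assumes "usc_on D u" "open D" "\<And>t. a + cis t *s b \<in> D"
  shows "(\<lambda>t. if t \<in> {0..2*pi} then u (a + cis t *s b) else 0) \<in> borel_measurable borel"
proof (rule borel_measurableI_less)
  fix y
  have o: "open {z \<in> D. u z < y}"
    using assms(1,2) openin_open_eq unfolding usc_on_def by blast
  have cont: "continuous_on UNIV (\<lambda>t. a + cis t *s b)"
    unfolding vector_scalar_mult_def by (intro continuous_intros)
  have op: "open ((\<lambda>t. a + cis t *s b) -` {z \<in> D. u z < y})"
    using open_vimage[OF o cont] .
  have "{x \<in> space borel. (if x \<in> {0..2*pi} then u (a + cis x *s b) else 0) < y}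
     = ({0..2*pi} \<inter> (\<lambda>t. a + cis t *s b) -` {z \<in> D. u z < y}) \<union> (if 0 < y then - {0..2*pi} else {})"
    using assms(3) by auto
  also have "\<dots> \<in> sets borel"
    using op by auto
  finally show "{x \<in> space borel. (if x \<in> {0..2*pi} then u (a + cis x *s b) else 0) < y} \<in> sets borel" .
qed

lemma ennreal_max_zero: "ennreal v = ennreal (max 0 v)"
  by (cases "0 \<le> v") (simp_all add: ennreal_neg)

text \<open>This is \<open>c x + K = (c x + K)\<^sup>+ - (c x + K)\<^sup>-\<close>, with each of \<open>c x + K\<close>, \<open>x\<close> and \<open>K\<close> split into
  its positive and negative part and all subtracted terms moved to the other side, so that
  it remains meaningful, with both sides infinite, for \<open>x = -\<infinity>\<close>.\<close>

lemma e2ennreal_affine_balance: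
  fixes x :: ereal
  assumes "x < \<infinity>" "0 < c"
  shows "e2ennreal (ereal c * x + ereal K) + (ennreal c * e2ennreal (- x) + ennreal (- K))
       = e2ennreal (- (ereal c * x + ereal K)) + (ennreal c * e2ennreal x + ennreal K)"
proof (cases x)
  case (real y)
  have "max 0 (c * y + K) + (c * max 0 (- y) + max 0 (- K))
      = max 0 (- (c * y + K)) + (c * max 0 y + max 0 K)"
  proof -
    have "c * max 0 (- y) = max 0 (- (c * y))" "c * max 0 y = max 0 (c * y)"
      using assms(2) by (simp_all add: max_def zero_le_mult_iff mult_le_0_iff)
    then show ?thesis by (simp add: max_def)
  qed
  moreover have "ennreal (max 0 p) + (ennreal c * ennreal (max 0 q) + ennreal (max 0 r))
      = ennreal (max 0 p + (c * max 0 q + max 0 r))" for p q r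
    using assms(2) by (simp add: ennreal_mult)
  ultimately have "ennreal (c * y + K) + (ennreal c * ennreal (- y) + ennreal (- K))
      = ennreal (- (c * y + K)) + (ennreal c * ennreal y + ennreal K)"
    by (metis ennreal_max_zero)
  then show ?thesis using real by simp
next
  case MInf
  then show ?thesis using assms(2) by (simp add: ennreal_mult_top)
qed (use assms in simp)

lemma e2ennreal_affine_pos_part:
  fixes x :: ereal
  assumes "x < \<infinity>" "0 < c"
  shows "ennreal c * e2ennreal x \<le> e2ennreal (ereal c * x + ereal K) + ennreal (- K)"
proof (cases x)
  case (real y)
  have "c * max 0 y \<le> max 0 (c * y + K) + max 0 (- K)"
    by (cases "0 \<le> y") (use assms(2) in \<open>auto simp: max_def\<close>)
  then have "ennreal (c * max 0 y) \<le> ennreal (max 0 (c * y + K) + max 0 (- K))"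
    by (rule ennreal_leI)
  then have "ennreal c * ennreal (max 0 y) \<le> ennreal (max 0 (c * y + K)) + ennreal (max 0 (- K))"
    using assms(2) by (simp add: ennreal_mult)
  then show ?thesis using real by (metis e2ennreal_ereal ennreal_max_zero plus_ereal.simps(1) times_ereal.simps(1))
qed (use assms in \<open>simp_all add: e2ennreal_neg\<close>)

text \<open>This is what carries the sub-mean value inequality over to \<open>c u + K\<close>. It follows by
  integrating the balance of positive and negative parts: if the positive part of \<open>c u + K\<close> has infinite integral,
  the right-hand side is \<open>\<infinity>\<close> by the convention \<open>\<infinity> - \<infinity> = \<infinity>\<close> in \<^typ>\<open>ereal\<close>; otherwise the
  positive part of \<open>u\<close> has finite integral as well. Then either the negative part of \<open>u\<close> has
  infinite integral and the left-hand side is \<open>-\<infinity>\<close>, or all integrals are finite and the balance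
  gives equality.\<close>

lemma circle_mean_affine:
  assumes "usc_on D u" "open D" "\<forall>z\<in>D. u z < \<infinity>" "\<And>t. a + cis t *s b \<in> D" "0 < c"
  shows "ereal c * circle_mean u a b + ereal K \<le> circle_mean (\<lambda>z. ereal c * u z + ereal K) a b"
proof -
  let ?g = "\<lambda>t. u (a + cis t *s b)"
  let ?I = "\<lambda>f. \<integral>\<^sup>+ t \<in> {0..2*pi}. f t \<partial>lborel"
  define h where "h = (\<lambda>t. if t \<in> {0..2*pi} then ?g t else 0)"
  let ?f = "\<lambda>t. ereal c * ?g t + ereal K"
  define k where "k = (\<lambda>t. ereal c * h t + ereal K)"
  have [measurable]: "h \<in> borel_measurable borel"
    unfolding h_def using usc_on_circle_measurable[OF assms(1,2,4)] .
  have [measurable]: "k \<in> borel_measurable borel" unfolding k_def by measurable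
  let ?ind = "\<lambda>t. indicator {0..2*pi} t :: ennreal"
  define P where "P = ?I (\<lambda>t. e2ennreal (?g t))"
  define N where "N = ?I (\<lambda>t. e2ennreal (- ?g t))"
  define A where "A = ?I (\<lambda>t. e2ennreal (?f t))"
  define B where "B = ?I (\<lambda>t. e2ennreal (- ?f t))"
  have P: "P = (\<integral>\<^sup>+ t. e2ennreal (h t) * ?ind t \<partial>lborel)"
   and N: "N = (\<integral>\<^sup>+ t. e2ennreal (- h t) * ?ind t \<partial>lborel)"
   and A: "A = (\<integral>\<^sup>+ t. e2ennreal (k t) * ?ind t \<partial>lborel)"
   and B: "B = (\<integral>\<^sup>+ t. e2ennreal (- k t) * ?ind t \<partial>lborel)"
    unfolding P_def N_def A_def B_def h_def k_def
    by (auto intro!: nn_integral_cong simp: indicator_def)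
  have K: "(\<integral>\<^sup>+ t. ennreal L * ?ind t \<partial>lborel) = ennreal (2 * pi) * ennreal L" for L
    by (simp add: nn_integral_cmult_indicator mult.commute)
  have 1: "A + (ennreal c * N + ennreal (2 * pi) * ennreal (- K))
     = (\<integral>\<^sup>+ t. e2ennreal (k t) * ?ind t + (ennreal c * (e2ennreal (- h t) * ?ind t) + ennreal (- K) * ?ind t) \<partial>lborel)"
    unfolding A N K[symmetric] by (simp add: nn_integral_add nn_integral_cmult)
  have 2: "B + (ennreal c * P + ennreal (2 * pi) * ennreal K)
     = (\<integral>\<^sup>+ t. e2ennreal (- k t) * ?ind t + (ennreal c * (e2ennreal (h t) * ?ind t) + ennreal K * ?ind t) \<partial>lborel)"
    unfolding B P K[symmetric] by (simp add: nn_integral_add nn_integral_cmult)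
  have balance: "A + (ennreal c * N + ennreal (2 * pi) * ennreal (- K)) = B + (ennreal c * P + ennreal (2 * pi) * ennreal K)"
    unfolding 1 2
  proof (rule nn_integral_cong)
    fix t
    have "h t < \<infinity>" using assms(3,4) by (simp add: h_def)
    from e2ennreal_affine_balance[OF this, of c K] assms(5)
    show "e2ennreal (k t) * ?ind t + (ennreal c * (e2ennreal (- h t) * ?ind t) + ennreal (- K) * ?ind t)
      = e2ennreal (- k t) * ?ind t + (ennreal c * (e2ennreal (h t) * ?ind t) + ennreal K * ?ind t)"
      by (cases "t \<in> {0..2*pi}") (simp_all add: k_def)
  qed
  have "ereal c * (ereal (1 / (2 * pi)) * (enn2ereal P - enn2ereal N)) + ereal K
     \<le> ereal (1 / (2 * pi)) * (enn2ereal A - enn2ereal B)"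
  proof (cases "A = top")
    case True
    then show ?thesis by (simp add: minus_ereal_def)
  next
    case False
    then obtain A' where A': "A = ennreal A'" "0 \<le> A'" by (cases A) auto
    have "ennreal c * P \<le> A + ennreal (2 * pi) * ennreal (- K)"
    proof -
      have "ennreal c * P = (\<integral>\<^sup>+ t. ennreal c * (e2ennreal (h t) * ?ind t) \<partial>lborel)"
        unfolding P by (simp add: nn_integral_cmult)
      also have "\<dots> \<le> (\<integral>\<^sup>+ t. e2ennreal (k t) * ?ind t + ennreal (- K) * ?ind t \<partial>lborel)"
      proof (rule nn_integral_mono)
        fix t
        have "h t < \<infinity>" using assms(3,4) by (simp add: h_def)
        from e2ennreal_affine_pos_part[OF this, of c K] assms(5)
        show "ennreal c * (e2ennreal (h t) * ?ind t) \<le> e2ennreal (k t) * ?ind t + ennreal (- K) * ?ind t"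
          by (cases "t \<in> {0..2*pi}") (simp_all add: k_def)
      qed
      also have "\<dots> = A + ennreal (2 * pi) * ennreal (- K)"
        unfolding A K[symmetric] by (simp add: nn_integral_add)
      finally show ?thesis .
    qed
    also have "\<dots> < top" using A' by (simp add: ennreal_mult_less_top)
    finally have "P \<noteq> top" using assms(5) by (auto simp: ennreal_mult_top)
    then obtain P' where P': "P = ennreal P'" "0 \<le> P'" by (cases P) auto
    show ?thesis
    proof (cases N)
      case top
      then show ?thesis using P' assms(5) by (simp add: minus_ereal_def)
    next
      case (real N')
      have "B \<le> A + (ennreal c * N + ennreal (2 * pi) * ennreal (- K))"
        unfolding balance by simp
      also have "\<dots> < top" using A' real by (simp add: ennreal_mult_less_top)
      finally obtain B' where B': "B = ennreal B'" "0 \<le> B'" by (cases B) auto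
      have "A' + (c * N' + 2 * pi * max 0 (- K)) = B' + (c * P' + 2 * pi * max 0 K)"
        using balance A' B' P' real assms(5) ennreal_max_zero[of K] ennreal_max_zero[of "- K"]
        by (simp add: ennreal_mult'[symmetric] flip: ennreal_plus)
      then have "A' - B' = c * (P' - N') + 2 * pi * K"
        by (simp add: algebra_simps max_def split: if_splits)
      then have "1 / (2 * pi) * (A' - B') = c * (1 / (2 * pi) * (P' - N')) + K"
        by (simp add: field_simps)
      then show ?thesis using A' B' P' real by simp
    qed
  qed
  then show ?thesis
    unfolding circle_mean_def P_def N_def A_def B_def .
qed

lemma psh_on_affine:
  assumes "psh_on D u" "0 < c"
  shows "psh_on D (\<lambda>z. ereal c * u z + ereal K)"
  unfolding psh_on_def
proof (intro conjI allI impI ballI)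
  show "open D" using assms(1) unfolding psh_on_def by blast
  show "usc_on D (\<lambda>z. ereal c * u z + ereal K)"
    using assms usc_on_affine unfolding psh_on_def by blast
  have fin: "\<forall>z\<in>D. u z < \<infinity>" using assms(1) unfolding psh_on_def by blast
  show "ereal c * u z + ereal K < \<infinity>" if "z \<in> D" for z
    using fin that assms(2) by (cases "u z") auto
  obtain z where z: "z \<in> D" "u z \<noteq> -\<infinity>" using assms(1) unfolding psh_on_def by blast
  show "\<exists>z\<in>D. ereal c * u z + ereal K \<noteq> -\<infinity>"
    using z fin assms(2) by (intro bexI[of _ z]) (cases "u z", auto)
  fix a b assume disc: "{a + \<zeta> *s b |\<zeta>. cmod \<zeta> \<le> 1} \<subseteq> D"
  then have circ: "a + cis t *s b \<in> D" for t by force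
  have "u a \<le> circle_mean u a b"
    using assms(1) disc unfolding psh_on_def by blast
  then have "ereal c * u a + ereal K \<le> ereal c * circle_mean u a b + ereal K"
    using assms(2) by (intro add_right_mono ereal_mult_left_mono) auto
  also have "\<dots> \<le> circle_mean (\<lambda>z. ereal c * u z + ereal K) a b"
    using assms fin circ unfolding psh_on_def by (intro circle_mean_affine[of D]) auto
  finally show "ereal c * u a + ereal K \<le> circle_mean (\<lambda>z. ereal c * u z + ereal K) a b" .
qed

text \<open>The neutral element of the sum of singularities is a genuine singularity, which makes it
  possible to evaluate the empty tail of a finite sum.\<close>

lemma zero_in_PSHG0: "(\<lambda>z :: complex^'n. 0) \<in> PSHG0"
proof -
  let ?B = "ball 0 1 :: (complex^'n) set"
  have "usc_on ?B (\<lambda>z. 0)"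
    unfolding usc_on_def
  proof
    fix c :: ereal
    have "{z \<in> ?B. 0 < c} = (if 0 < c then ?B else {})" by auto
    then show "openin (top_of_set ?B) {z \<in> ?B. 0 < c}" by simp
  qed
  moreover have "0 \<in> ?B" by simp
  moreover have "circle_mean (\<lambda>z :: complex^'n. 0) a b = 0" for a b
    unfolding circle_mean_def by (simp add: e2ennreal_neg zero_ennreal.rep_eq)
  ultimately have "psh_on ?B (\<lambda>z. 0)"
    unfolding psh_on_def by (intro conjI ballI allI impI bexI[of _ 0]) simp_all
  then show ?thesis unfolding PSHG0_def using zero_less_one by blast
qed

section \<open>The relative type as a sharp bound\<close>

lemma locally_bounded_on_compact:
  assumes "locally_bounded_on S u" "compact T" "T \<subseteq> S"
  shows "\<exists>M::real. \<forall>z\<in>T. \<bar>u z\<bar> \<le> ereal M"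
proof -
  have "\<forall>z\<in>T. \<exists>e>0. \<exists>M::real. \<forall>w \<in> S \<inter> ball z e. \<bar>u w\<bar> \<le> ereal M"
    using assms unfolding locally_bounded_on_def by blast
  then obtain e M where eM: "\<And>z. z \<in> T \<Longrightarrow> 0 < e z"
      "\<And>z w. z \<in> T \<Longrightarrow> w \<in> S \<inter> ball z (e z) \<Longrightarrow> \<bar>u w\<bar> \<le> ereal (M z)"
    by metis
  have cover: "T \<subseteq> (\<Union>z\<in>T. ball z (e z))" using eM(1) by force
  obtain F where F: "F \<subseteq> T" "finite F" "T \<subseteq> (\<Union>z\<in>F. ball z (e z))"
    by (rule compactE_image[OF assms(2) _ cover]) auto
  have "\<bar>u w\<bar> \<le> ereal (\<Sum>z\<in>F. \<bar>M z\<bar>)" if w: "w \<in> T" for w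
  proof -
    obtain z where z: "z \<in> F" "w \<in> ball z (e z)" using F(3) w by blast
    have "\<bar>u w\<bar> \<le> ereal (M z)" using eM(2) z F(1) w assms(3) by blast
    also have "M z \<le> (\<Sum>z\<in>F. \<bar>M z\<bar>)"
      using member_le_sum[OF z(1), of "\<lambda>z. \<bar>M z\<bar>"] F(2) by simp
    finally show ?thesis by simp
  qed
  then show ?thesis by blast
qed

lemma usc_on_eventually_less:
  assumes "usc_on D u" "open D" "x \<in> D" "u x < M"
  shows "\<forall>\<^sub>F z in nhds x. u z < M"
proof -
  have "open {z \<in> D. u z < M}"
    using assms(1,2) openin_open_eq unfolding usc_on_def by blast
  then have "\<forall>\<^sub>F z in nhds x. z \<in> {z \<in> D. u z < M}"
    using assms(3,4) by (intro eventually_nhds_in_open) auto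
  then show ?thesis by eventually_elim simp
qed

lemma PSHG0_bounded_above:
  assumes "u \<in> PSHG0"
  obtains M where "0 < M" "\<forall>\<^sub>F z in nhds 0. u z < ereal M"
proof -
  obtain r where r: "r > 0" "psh_on (ball 0 r) u"
    using assms unfolding PSHG0_def by blast
  have "u 0 < \<infinity>" using r unfolding psh_on_def by simp
  then obtain K where "u 0 < ereal K" using ereal_dense2 by blast
  then have "u 0 < ereal (max 1 K)" by (rule less_le_trans) simp
  then obtain M where M: "0 < M" "u 0 < ereal M"
    by (metis less_max_iff_disj zero_less_one)
  with r have "\<forall>\<^sub>F z in nhds 0. u z < ereal M"
    unfolding psh_on_def by (intro usc_on_eventually_less[of "ball 0 r"]) auto
  with M show ?thesis using that by blast
qed

text \<open>The inequality to be shown is \<open>(u - C) / t \<le> \<phi>\<close>, and the left-hand side is again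
  plurisubharmonic, so maximality of \<open>\<phi>\<close> applies on the shell, whose frontier lies in the two
  spheres.\<close>

lemma maximal_psh_shell_bound:
  fixes u \<phi> :: "complex^'n \<Rightarrow> ereal"
  assumes max: "maximal_psh_on (ball 0 R - {0}) \<phi>" and u: "psh_on (ball 0 R') u"
    and r: "0 < d" "r < R" "r < R'" and t: "0 < t"
    and outer: "\<And>w. norm w = r \<Longrightarrow> u w \<le> ereal t * \<phi> w + ereal C"
    and inner: "\<And>w. norm w = d \<Longrightarrow> u w \<le> ereal t * \<phi> w + ereal C"
    and z: "d < norm z" "norm z < r"
  shows "u z \<le> ereal t * \<phi> z + ereal C"
proof (cases "u z = -\<infinity>")
  \<comment> \<open>A competitor must not be identically \<open>-\<infinity>\<close> on the shell; the point \<open>z\<close> itself witnesses this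
    unless the claim is trivial.\<close>
  case False
  let ?G = "ball 0 r - cball 0 d :: (complex^'n) set"
  let ?v = "\<lambda>w. ereal (1 / t) * u w + ereal (- C / t)"
  have G: "open ?G" "z \<in> ?G" using z by auto
  have "?G \<subseteq> cball 0 r - ball 0 d" by auto
  moreover have "closed (cball 0 r - ball 0 d :: (complex^'n) set)" by (intro closed_Diff) auto
  ultimately have clos: "closure ?G \<subseteq> cball 0 r - ball 0 d" by (rule closure_minimal)
  have sub: "closure ?G \<subseteq> ball 0 R - {0}" using clos r by force
  have comp: "compact (closure ?G)" by (simp add: bounded_diff compact_closure)
  have front: "norm w = r \<or> norm w = d" if "w \<in> frontier ?G" for w
    using that clos G(1) unfolding frontier_def by (force simp: interior_open)
  have "?G \<subseteq> ball 0 R'" using r by auto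
  then have "psh_on ?G u" using psh_on_subset[OF u G(1)] False G(2) by blast
  then have pv: "psh_on ?G ?v" using t by (intro psh_on_affine) auto
  have "usc_on (ball 0 R') u" using u unfolding psh_on_def by blast
  moreover have "closure ?G \<subseteq> ball 0 R'" using clos r by force
  ultimately have "usc_on (closure ?G) u" by (rule usc_on_subset)
  then have uv: "usc_on (closure ?G) ?v" using t by (intro usc_on_affine) auto
  have fin: "\<phi> w < \<infinity>" if "w \<in> ball 0 R - {0}" for w
    using max that unfolding maximal_psh_on_def psh_on_def by blast
  have le: "?v w \<le> \<phi> w \<longleftrightarrow> u w \<le> ereal t * \<phi> w + ereal C" for w
    using t by (cases "u w"; cases "\<phi> w") (auto simp: field_simps)
  have "\<forall>w\<in>frontier ?G. ?v w \<le> \<phi> w"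
    unfolding le using front outer inner by blast
  then have "\<forall>w\<in>?G. ?v w \<le> \<phi> w"
    using max G(1) comp sub uv pv unfolding maximal_psh_on_def by blast
  then show ?thesis using G(2) le by blast
qed simp

text \<open>The additive constant comes from the outer sphere alone, where \<open>u\<close> is bounded above and \<open>\<phi>\<close>
  is bounded; hence it serves all \<open>t < s\<close> simultaneously and survives the limit \<open>t \<rightarrow> s\<close>.\<close>

lemma psh_le_rel_type:
  fixes u \<phi> :: "complex^'n \<Rightarrow> ereal"
  assumes u: "u \<in> PSHG0" and \<Phi>: "isolated_sing \<Phi>" "\<phi> \<in> \<Phi>"
    and max: "0 < r0" "maximal_psh_on (ball 0 r0 - {0}) \<phi>"
    and s: "0 \<le> s" "Liminf (at 0) (\<lambda>z. u z / \<phi> z) = ereal s"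
  shows "\<exists>C::real. \<forall>\<^sub>F z in at 0. u z \<le> ereal s * \<phi> z + ereal C"
proof -
  obtain M where M: "0 < M" "\<forall>\<^sub>F z in nhds 0. u z < ereal M"
    using PSHG0_bounded_above[OF u] .
  show ?thesis
  proof (cases "s = 0")
    \<comment> \<open>There is no \<open>t\<close> with \<open>0 < t < s\<close>, but the claim only says that \<open>u\<close> is bounded above.\<close>
    case True
    have "\<forall>\<^sub>F z in at 0. u z \<le> ereal s * \<phi> z + ereal M"
      using M(2) True unfolding eventually_at_filter
      by (auto elim!: eventually_mono simp flip: zero_ereal_def)
    then show ?thesis by blast
  next
    case False
    with s(1) have s0: "0 < s" by simp
    obtain r1 where r1: "0 < r1" "psh_on (ball 0 r1) u"
      using u unfolding PSHG0_def by blast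
    obtain r2 where r2: "0 < r2" "locally_bounded_on (ball 0 r2 - {0}) \<phi>"
      using \<Phi> unfolding isolated_sing_def by blast
    obtain r3 where r3: "0 < r3" "\<And>z. dist z 0 < r3 \<Longrightarrow> u z < ereal M"
      using M(2) unfolding eventually_nhds_metric by blast
    have "\<forall>\<^sub>F z in at 0. \<bar>\<phi> z\<bar> < \<infinity> \<and> \<phi> z < 0"
      using isolated_sing_finite[OF \<Phi>] isolated_sing_less[OF \<Phi>, of 0]
      by eventually_elim (simp add: zero_ereal_def)
    then obtain r4 where r4: "0 < r4" "\<And>z. z \<noteq> 0 \<Longrightarrow> dist z 0 < r4 \<Longrightarrow> \<bar>\<phi> z\<bar> < \<infinity> \<and> \<phi> z < 0"
      unfolding eventually_at by blast
    \<comment> \<open>The radius of the outer sphere: all local properties hold up to and including it.\<close>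
    define r where "r = Min {r0, r1, r2, r3, r4} / 2"
    have r: "0 < r" "r < r0" "r < r1" "r < r2" "r < r3" "r < r4"
      using max(1) r1(1) r2(1) r3(1) r4(1) unfolding r_def by (auto simp: min_def)
    have "sphere 0 r \<subseteq> ball 0 r2 - {0 :: complex^'n}" using r by auto
    from locally_bounded_on_compact[OF r2(2) compact_sphere this]
    obtain L where "\<forall>z\<in>sphere 0 r. \<bar>\<phi> z\<bar> \<le> ereal L" by blast
    then have L: "\<bar>\<phi> z\<bar> \<le> ereal L" if "norm z = r" for z using that by simp
    define C where "C = M + s * \<bar>L\<bar>"
    have bound: "u z \<le> ereal t * \<phi> z + ereal C" if z: "z \<noteq> 0" "norm z < r" and t: "0 < t" "t < s" for z t
    proof -
      have "\<forall>\<^sub>F w in at 0. ereal t < u w / \<phi> w"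
        using t(2) s(2) by (intro less_LiminfD) auto
      then obtain d0 where d0: "0 < d0" "\<And>w. w \<noteq> 0 \<Longrightarrow> dist w 0 < d0 \<Longrightarrow> ereal t < u w / \<phi> w"
        unfolding eventually_at by blast
      \<comment> \<open>The inner sphere must separate \<open>z\<close> from 0 and lie where the lower limit has taken effect.\<close>
      define d where "d = min d0 (norm z) / 2"
      have d: "0 < d" "d < d0" "d < norm z" "d < r4"
        using d0(1) z r(6) norm_ge_zero[of z] unfolding d_def zero_less_norm_iff[symmetric] by linarith+
      show ?thesis
      proof (rule maximal_psh_shell_bound[OF max(2) r1(2)])
        fix w :: "complex^'n"
        show "u w \<le> ereal t * \<phi> w + ereal C" if w: "norm w = r"
        proof -
          have "u w < ereal M" using r3(2)[of w] w r by simp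
          moreover obtain p where p: "\<phi> w = ereal p" "- \<bar>L\<bar> \<le> p"
            using L[OF w] by (cases "\<phi> w") auto
          have "s * \<bar>L\<bar> \<ge> t * \<bar>L\<bar>" using t by (intro mult_right_mono) auto
          moreover have "t * (- \<bar>L\<bar>) \<le> t * p" using t p by (intro mult_left_mono) auto
          ultimately have "M \<le> t * p + C" unfolding C_def by simp
          then show ?thesis using p \<open>u w < ereal M\<close> by (cases "u w") auto
        qed
        show "u w \<le> ereal t * \<phi> w + ereal C" if w: "norm w = d"
        proof -
          have w0: "w \<noteq> 0" using w d by auto
          obtain p where p: "\<phi> w = ereal p" "p < 0"
            using r4(2)[OF w0] w d by (cases "\<phi> w") auto
          have 1: "ereal t < u w / ereal p" using d0(2)[OF w0] w d p by simp
          have "0 \<le> C" using M s unfolding C_def by simp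
          with 1 p show ?thesis
            by (cases "u w") (auto simp: field_simps)
        qed
      qed (use d r z t in auto)
    qed
    have "u z \<le> ereal s * \<phi> z + ereal C" if z: "z \<noteq> 0" "norm z < r" for z
    proof -
      obtain p where p: "\<phi> z = ereal p"
        using r4(2)[OF z(1)] z r by (cases "\<phi> z") auto
      show ?thesis
      proof (cases "u z")
        case (real x)
        have "\<forall>\<^sub>F t in at_left s. x \<le> t * p + C"
          using eventually_at_left_real[OF s0]
        proof eventually_elim
          case (elim t)
          then show ?case using bound[OF z, of t] real p by simp
        qed
        moreover have "((\<lambda>t. t * p + C) \<longlongrightarrow> s * p + C) (at_left s)"
          by (intro tendsto_intros)
        ultimately have "x \<le> s * p + C"
          by (intro tendsto_lowerbound[of "\<lambda>t. t * p + C"]) auto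
        then show ?thesis using real p by simp
      next
        case PInf
        then show ?thesis using bound[OF z, of "s/2"] s0 p by simp
      qed simp
    qed
    then have "\<forall>\<^sub>F z in at 0. u z \<le> ereal s * \<phi> z + ereal C"
      unfolding eventually_at using r(1) by (intro exI[of _ r]) auto
    then show ?thesis by blast
  qed
qed

text \<open>The numerator is bounded above while \<open>\<phi>\<close> tends to \<open>-\<infinity>\<close>.\<close>

lemma rel_type_nonneg:
  assumes "U \<in> PSHS0" "isolated_sing \<Phi>"
  shows "0 \<le> rel_type U \<Phi>"
proof -
  obtain u \<phi> where u: "u \<in> U" and \<phi>: "\<phi> \<in> \<Phi>"
    using assms PSHS0_nonempty unfolding isolated_sing_def by blast
  obtain M where M: "0 < M" "\<forall>\<^sub>F z in nhds 0. u z < ereal M"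
    using PSHG0_bounded_above[OF PSHS0_reps(1)[OF assms(1) u u]] .
  have "\<forall>\<^sub>F z in at 0. y < u z / \<phi> z" if y: "y < 0" for y
  proof -
    obtain e where e: "y < ereal e" "ereal e < 0"
      using ereal_dense2[OF y] by blast
    have M': "\<forall>\<^sub>F z in at 0. u z < ereal M"
      using M(2) unfolding eventually_at_filter by eventually_elim simp
    from M' isolated_sing_finite[OF assms(2) \<phi>] isolated_sing_less[OF assms(2) \<phi>, of "min 0 (M / e)"]
    have "\<forall>\<^sub>F z in at 0. ereal e < u z / \<phi> z"
    proof eventually_elim
      case (elim z)
      then obtain p where p: "\<phi> z = ereal p" "p < 0" "p < M / e" by (cases "\<phi> z") auto
      have "M < e * p" using p e by (simp add: field_simps)
      then show ?case using elim(1) p by (cases "u z") (auto simp: field_simps)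
    qed
    then show ?thesis using e(1) by (auto elim!: eventually_mono)
  qed
  then show ?thesis
    unfolding rel_type_eq[OF assms u \<phi>] le_Liminf_iff by blast
qed

lemma rel_type_self:
  fixes \<Phi> :: "(complex^'n \<Rightarrow> ereal) set"
  assumes "isolated_sing \<Phi>"
  shows "rel_type \<Phi> \<Phi> = 1"
proof -
  have \<Phi>: "\<Phi> \<in> PSHS0" using assms unfolding isolated_sing_def by blast
  then obtain \<phi> where \<phi>: "\<phi> \<in> \<Phi>" using PSHS0_nonempty by blast
  have "\<forall>\<^sub>F z in at 0. \<phi> z / \<phi> z = 1"
    using isolated_sing_finite[OF assms \<phi>] isolated_sing_less[OF assms \<phi>, of 0]
  proof eventually_elim
    case (elim z)
    then show ?case by (cases "\<phi> z") (auto simp: one_ereal_def)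
  qed
  then have "Liminf (at 0) (\<lambda>z. \<phi> z / \<phi> z) = Liminf (at 0) (\<lambda>z :: complex^'n. 1)"
    by (rule Liminf_eq)
  then show ?thesis
    unfolding rel_type_eq[OF \<Phi> assms \<phi> \<phi>] by (simp add: Liminf_const)
qed

lemma sing_add_zero:
  assumes "U \<in> PSHS0"
  shows "sing_add U sing_zero = U"
proof -
  obtain u where "u \<in> PSHG0" "U = cl u" using assms unfolding PSHS0_def by blast
  then show ?thesis
    using sing_add_cl[OF _ zero_in_PSHG0, of u] unfolding sing_zero_def by simp
qed

lemma cl_representative:
  assumes "U \<in> PSHS0" "u \<in> U"
  shows "U = cl u"
proof -
  obtain v where v: "U = cl v" using assms(1) by (auto simp: PSHS0_def)
  then have "sing_equiv u v" using assms(2) by (simp add: cl_def)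
  then show ?thesis unfolding v by (rule cl_eq[symmetric])
qed

section \<open>Additive singularities are extreme\<close>

theorem theorem3p7:
  fixes \<Phi> :: "(complex^'n \<Rightarrow> ereal) set"
  assumes "maximal_sing \<Phi>" and "additive_sing \<Phi>"
  shows "extreme_sing \<Phi>"
proof -
  have iso: "isolated_sing \<Phi>" using assms(1) unfolding maximal_sing_def by blast
  then have \<Phi>: "\<Phi> \<in> PSHS0" unfolding isolated_sing_def by blast
  obtain \<phi> r where \<phi>: "\<phi> \<in> \<Phi>" and r: "0 < r" "maximal_psh_on (ball 0 r - {0}) \<phi>"
    using assms(1) unfolding maximal_sing_def by blast
  have "(\<exists>c1\<ge>0. U1 = sing_scale c1 \<Phi>) \<and> (\<exists>c2\<ge>0. U2 = sing_scale c2 \<Phi>)"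
    if U: "U1 \<in> PSHS0" "U2 \<in> PSHS0" and decomp: "\<Phi> = sing_add U1 U2" for U1 U2
  proof -
    obtain u1 u2 where u: "u1 \<in> U1" "u2 \<in> U2" using U PSHS0_nonempty by blast
    have g: "u1 \<in> PSHG0" "u2 \<in> PSHG0" using U u PSHS0_reps(1) by blast+
    have cls: "U1 = cl u1" "U2 = cl u2" "\<Phi> = cl \<phi>"
      using cl_representative U u \<Phi> \<phi> by blast+
    have "sing_sum [U1, U2] = \<Phi>"
      unfolding sing_sum_def using sing_add_zero[OF U(2)] decomp by simp
    moreover have "rel_type (sing_sum [U1, U2]) \<Phi> = (\<Sum>V\<leftarrow>[U1, U2]. rel_type V \<Phi>)"
      using assms(2) U unfolding additive_sing_def by (metis empty_set empty_subsetI insert_subset list.simps(15))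
    ultimately have sum1: "rel_type U1 \<Phi> + rel_type U2 \<Phi> = 1"
      using rel_type_self[OF iso] by simp
    obtain s1 s2 where s: "rel_type U1 \<Phi> = ereal s1" "rel_type U2 \<Phi> = ereal s2"
        "0 \<le> s1" "0 \<le> s2" "s1 + s2 = 1"
      using sum1 rel_type_nonneg[OF U(1) iso] rel_type_nonneg[OF U(2) iso]
      by (cases "rel_type U1 \<Phi>"; cases "rel_type U2 \<Phi>") (auto simp: one_ereal_def)
    obtain C1 where C1: "\<forall>\<^sub>F z in at 0. u1 z \<le> ereal s1 * \<phi> z + ereal C1"
      using psh_le_rel_type[OF g(1) iso \<phi> r s(3)] rel_type_eq[OF U(1) iso u(1) \<phi>] s(1) by auto
    obtain C2 where C2: "\<forall>\<^sub>F z in at 0. u2 z \<le> ereal s2 * \<phi> z + ereal C2"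
      using psh_le_rel_type[OF g(2) iso \<phi> r s(4)] rel_type_eq[OF U(2) iso u(2) \<phi>] s(2) by auto
    have "\<phi> \<in> cl (\<lambda>z. u1 z + u2 z)"
      using \<phi> unfolding decomp cls sing_add_cl[OF g] .
    then obtain C where C: "\<forall>\<^sub>F z in at 0. \<phi> z \<le> u1 z + u2 z + ereal C \<and> u1 z + u2 z \<le> \<phi> z + ereal C"
      unfolding cl_def sing_equiv_def by blast
    \<comment> \<open>One constant for all four inequalities: the upper bound of one summand, combined with
      \<open>\<phi> \<le> u\<^sub>1 + u\<^sub>2 + C\<close>, is the lower bound of the other.\<close>
    define K where "K = \<bar>C1\<bar> + \<bar>C2\<bar> + \<bar>C\<bar>"
    from C1 C2 C isolated_sing_finite[OF iso \<phi>]
    have ev: "\<forall>\<^sub>F z in at 0.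
        (u1 z \<le> ereal s1 * \<phi> z + ereal K \<and> ereal s1 * \<phi> z \<le> u1 z + ereal K) \<and>
        (u2 z \<le> ereal s2 * \<phi> z + ereal K \<and> ereal s2 * \<phi> z \<le> u2 z + ereal K)"
    proof eventually_elim
      case (elim z)
      obtain p where p: "\<phi> z = ereal p" using elim(4) by (cases "\<phi> z") auto
      obtain x1 x2 where x: "u1 z = ereal x1" "u2 z = ereal x2"
        using elim p by (cases "u1 z"; cases "u2 z") auto
      have "x1 \<le> s1 * p + C1" "x2 \<le> s2 * p + C2" "p \<le> x1 + x2 + C"
        using elim p x by auto
      moreover have "p = s1 * p + s2 * p" using s(5) by (metis distrib_right mult_1)
      ultimately have "x1 \<le> s1 * p + K" "s1 * p \<le> x1 + K" "x2 \<le> s2 * p + K" "s2 * p \<le> x2 + K"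
        unfolding K_def by linarith+
      then show ?case unfolding p x by simp
    qed
    have "sing_equiv u1 (\<lambda>z. ereal s1 * \<phi> z)" "sing_equiv u2 (\<lambda>z. ereal s2 * \<phi> z)"
      unfolding sing_equiv_def using ev by (auto intro!: exI[of _ K] elim!: eventually_mono)
    then have "U1 = sing_scale s1 \<Phi>" "U2 = sing_scale s2 \<Phi>"
      using sing_scale_cl[of \<phi>] PSHS0_reps(1)[OF \<Phi> \<phi> \<phi>] s cls cl_eq by metis+
    with s show ?thesis by blast
  qed
  with \<Phi> show ?thesis unfolding extreme_sing_def by blast
qed

end
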